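(* Let $\{\alpha_n\}_{n\ge1}\subset(0,1]$ and $B:=\sum_{n\ge1}(1-\alpha_n)\in(0,\infty]$. Consider the function $f:=\lim_{n\to\infty}f_{\alpha_1}*\cdots*f_{\alpha_n}$. Then the following hold. (i) If $B>1$, then $f$ is bounded. (ii) If $B=1$, then $$\lim_{z\to1}\frac{f(z)}{-\log(1-|z|)}=\frac12\prod_{n=1}^\infty\frac{1}{\Gamma(\alpha_n+1)}.$$ (iii) If $B<1$, then $$\lim_{z\to1}(1-|z|)^{1-B}f(z)=\frac{\Gamma(1-B)}{2^B}\prod_{n=1}^\infty\frac{1}{\Gamma(\alpha_n+1)}.$$
   Context: Let $\mathbb{D}$ be the open unit disk in $\mathbb{C}$; the variable $z$ ranges over $\mathbb{D}$. For $\alpha\in(0,1]$ let $f_\alpha(z)=\frac{1}{2\alpha}\left(\left(\frac{1+z}{1-z}\right)^\alpha-1\right)$, $z\in\mathbb{D}$ (principal branch of the power); in particular $f_1(z)=\frac{z}{1-z}$. For holomorphic functions $f(z)=\sum_{n\ge0}a_nz^n$ and $g(z)=\sum_{n\ge0}b_nz^n$ in $\mathbb{D}$, the convolution (Hadamard product) is $(f*g)(z)=\sum_{n\ge0}a_nb_nz^n$. Limits of sequences of holomorphic functions are taken uniformly on compact subsets of $\mathbb{D}$. $\Gamma$ denotes the Euler Gamma function.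
   Formalization: In (ii) and (iii) the limit z→1 is taken radially (z=r, r→1−); over unrestricted z in the disk the claims fail, e.g. in (iii) for α=(1/2,1,1,…), where (1−|z|)^{1/2}f(z) tends to √2 radially but to 0 along tangential approach. *)

theory Defs
  imports "HOL-Complex_Analysis.Complex_Analysis"
begin

definition f_alpha :: "real \<Rightarrow> complex \<Rightarrow> complex" where
  "f_alpha a z = (((1 + z) / (1 - z)) powr (complex_of_real a) - 1) / (2 * complex_of_real a)"

(* Intended for f, g holomorphic on the open unit disk and z in that disk; the value
   at any other z is irrelevant. *)
definition hadamard :: "(complex \<Rightarrow> complex) \<Rightarrow> (complex \<Rightarrow> complex) \<Rightarrow> complex \<Rightarrow> complex" where
  "hadamard f g z =
     (\<Sum>n. fps_nth (fps_expansion f 0) n * fps_nth (fps_expansion g 0) n * z ^ n)"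

(* Sequences are indexed from 0: a 0, a 1, ... stand for alpha_1, alpha_2, ..., so
   conv_f a n is the convolution of the first n + 1 functions. *)
primrec conv_f :: "(nat \<Rightarrow> real) \<Rightarrow> nat \<Rightarrow> complex \<Rightarrow> complex" where
  "conv_f a 0 = f_alpha (a 0)"
| "conv_f a (Suc n) = hadamard (conv_f a n) (f_alpha (a (Suc n)))"

definition loc_unif_limit_disk :: "(nat \<Rightarrow> complex \<Rightarrow> complex) \<Rightarrow> (complex \<Rightarrow> complex) \<Rightarrow> bool" where
  "loc_unif_limit_disk F f \<longleftrightarrow>
     (\<forall>K. compact K \<and> K \<subseteq> ball 0 1 \<longrightarrow> uniform_limit K F f sequentially)"

(* The limits z --> 1 are read radially: the weights 1 - |z| and -log(1 - |z|) depend on |z|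
   only, whereas f is comparable to a power (or the logarithm) of 1 - z near 1. For example,
   for the exponents 1/2, 1, 1, ... (f = f_alpha (1/2), B = 1/2) the expression in the case
   B < 1 has no limit for unrestricted z --> 1 in the disk, nor for z --> 1 in a Stolz angle. *)
definition radial_at_1 :: "complex filter" where
  "radial_at_1 = at 1 within complex_of_real ` {0<..<1}"

end

theory Submission
  imports Defs "HOL-Real_Asymp.Real_Asymp"
begin

text \<open>
  On the level of power series the whole problem is about coefficients. Write
  \<open>A a k\<close> for the \<open>k\<close>-th coefficient of \<open>f_alpha a\<close>. All these numbers lie in \<open>[0, 1]\<close>, so the
  coefficients \<open>\<Prod>i\<le>n. A (\<alpha> i) k\<close> of the partial convolutions decrease in \<open>n\<close>, and their limits
  \<open>c k\<close> are the coefficients of the limit function \<open>f\<close>. It remains to find the growth of \<open>c k\<close> and to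
  translate it into the behaviour of \<open>f\<close> at the point 1.

  For a single factor, the equation \<open>(1 - z\<^sup>2) f' = 1 + 2 a f\<close> gives a three-term recurrence for
  \<open>A a k\<close>. The coefficients \<open>G a k\<close> of \<open>((1 - z) powr (-a) - 1) / a\<close> nearly satisfy it: \<open>G a k\<close> is a
  supersolution and \<open>a * G a (k - 1)\<close> a subsolution. This comparison gives
  \<open>a \<le> A a k * k powr (1 - a) \<le> 2 powr (1 - a)\<close> for every \<open>k \<ge> 1\<close> (\<open>coeff_f_powr_bounds\<close>); both bounds
  are \<open>1 + O(1 - a)\<close> as \<open>a\<close> tends to 1, uniformly in \<open>k\<close>.

  The exact constant comes from the quotients \<open>A a k / G a k\<close>. They converge, because their recurrence is an
  averaging procedure up to a summable error (\<open>convergent_coeff_ratio\<close>), and an Abelian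
  comparison of \<open>f_alpha a\<close> with \<open>((1 - r) powr (-a) - 1) / a\<close> as \<open>r\<close> tends to 1 shows that their
  limit can only be \<open>2 powr (a - 1)\<close>. Hence \<open>A a k * k powr (1 - a)\<close> tends to
  \<open>2 powr (a - 1) / Gamma (a + 1)\<close> (\<open>coeff_f_asymp\<close>).

  Let \<open>B = (\<Sum>i. 1 - \<alpha> i)\<close>. If \<open>B > 1\<close>, then finitely many factors already give \<open>c k = O(k powr (-s))\<close>
  with some \<open>s > 1\<close>, so the coefficients are summable and \<open>f\<close> is bounded. If \<open>B \<le> 1\<close>, then taking logarithms
  of the product turns the passage to the limit \<open>k \<rightarrow> \<infinity>\<close> into an application of Tannery's theorem, with
  the uniform bounds as majorant; the result is
  \<open>c k * k powr B \<longlonglongrightarrow> (\<Prod>i. 1 / Gamma (\<alpha> i + 1)) / 2 powr B\<close> (\<open>limit_coeff_asymp\<close>). The same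
  Abelian comparison, with \<open>G (1 - B)\<close> for \<open>B < 1\<close> and with the series of \<open>- ln (1 - r)\<close> for \<open>B = 1\<close>, then
  yields the two radial limits.
\<close>

section \<open>The coefficients of the factors\<close>

text \<open>The recurrence that the differential equation of \<open>f_alpha a\<close> imposes on its Taylor coefficients.\<close>
fun coeff_f :: "real \<Rightarrow> nat \<Rightarrow> real" where
  "coeff_f a 0 = 0"
| "coeff_f a (Suc 0) = 1"
| "coeff_f a (Suc (Suc k)) = (2 * a * coeff_f a (Suc k) + real k * coeff_f a k) / (real k + 2)"

lemma coeff_f_nonneg: "0 \<le> a \<Longrightarrow> 0 \<le> coeff_f a k"
  by (induction a k rule: coeff_f.induct) auto

lemma coeff_f_le_1: "0 \<le> a \<Longrightarrow> a \<le> 1 \<Longrightarrow> coeff_f a k \<le> 1"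
proof (induction a k rule: coeff_f.induct)
  case (3 a k)
  have "a * coeff_f a (Suc k) \<le> 1 * 1"
    using 3 by (intro mult_mono coeff_f_nonneg) auto
  moreover have "real k * coeff_f a k \<le> real k * 1"
    using 3 by (intro mult_left_mono) auto
  ultimately show ?case
    by (simp add: field_simps)
qed auto

lemma coeff_f_Suc_Suc:
  "coeff_f a (Suc (Suc k)) * (real k + 2) = 2 * a * coeff_f a (Suc k) + real k * coeff_f a k"
  by simp

text \<open>
  For \<open>z\<close> in the disk \<open>(1 + z) / (1 - z)\<close> has positive real part, so the principal branch of the power
  is holomorphic there. Differentiating a power reproduces the power, which is \<open>1 + 2 a f\<close>.
\<close>
lemma f_alpha_holomorphic: "f_alpha a holomorphic_on ball 0 1"
  and f_alpha_has_field_derivative: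
    "\<And>z. z \<in> ball 0 1 \<Longrightarrow> 0 < a \<Longrightarrow>
       (f_alpha a has_field_derivative (1 + 2 * complex_of_real a * f_alpha a z) / (1 - z ^ 2)) (at z)"
proof -
  have nonpos: "(1 + z) / (1 - z) \<notin> \<real>\<^sub>\<le>\<^sub>0" "1 - z \<noteq> 0" "1 + z \<noteq> 0" if "z \<in> ball 0 1" for z :: complex
  proof -
    have *: "1 - z \<noteq> 0" "1 + z \<noteq> 0"
      using that by (auto simp: add_eq_0_iff)
    have "Re ((1 + z) / (1 - z)) > 0"
    proof -
      have "(1 + Re z) * (1 - Re z) - Im z * Im z = 1 - norm z ^ 2"
        unfolding cmod_power2 by (simp add: algebra_simps power2_eq_square)
      also have "\<dots> > 0"
        using that by (simp add: power_less_one_iff abs_square_less_1)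
      finally have "(1 + Re z) * (1 - Re z) - Im z * Im z > 0" .
      moreover have "(1 - Re z)\<^sup>2 + (Im z)\<^sup>2 > 0"
        using * by (auto simp: sum_power2_gt_zero_iff complex_eq_iff)
      ultimately show ?thesis
        by (simp add: Re_divide)
    qed
    thus "(1 + z) / (1 - z) \<notin> \<real>\<^sub>\<le>\<^sub>0"
      by (auto simp: complex_nonpos_Reals_iff)
    show "1 - z \<noteq> 0" "1 + z \<noteq> 0" by fact+
  qed
  show "f_alpha a holomorphic_on ball 0 1"
    unfolding f_alpha_def using nonpos by (cases "a = 0") (auto intro!: holomorphic_intros)
  show "(f_alpha a has_field_derivative (1 + 2 * complex_of_real a * f_alpha a z) / (1 - z ^ 2)) (at z)"
    if z: "z \<in> ball 0 1" and "0 < a" for z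
  proof -
    note nz = nonpos[OF z]
    have sq: "1 - z ^ 2 = (1 - z) * (1 + z)"
      by (simp add: power2_eq_square algebra_simps)
    have "(f_alpha a has_field_derivative
       (complex_of_real a * ((1 + z) / (1 - z)) powr (complex_of_real a - 1) * (((1 - z) + (1 + z)) / ((1 - z) * (1 - z)))) /
        (2 * complex_of_real a)) (at z)"
      unfolding f_alpha_def
      by (rule derivative_eq_intros refl nz | use nz \<open>0 < a\<close> in \<open>simp add: divide_simps\<close>)+
    moreover have "1 + 2 * complex_of_real a * f_alpha a z = ((1 + z) / (1 - z)) powr complex_of_real a"
      using \<open>0 < a\<close> by (simp add: f_alpha_def)
    moreover have "(complex_of_real a * (W / ((1 + z) / (1 - z))) * (((1 - z) + (1 + z)) / ((1 - z) * (1 - z)))) /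
        (2 * complex_of_real a) = W / (1 - z ^ 2)" for W
      unfolding sq using nz \<open>0 < a\<close> by (simp add: divide_simps)
    moreover have "((1 + z) / (1 - z)) powr (complex_of_real a - 1) =
        ((1 + z) / (1 - z)) powr complex_of_real a / ((1 + z) / (1 - z))"
      using nz by (simp add: powr_diff)
    ultimately show ?thesis by (simp only:)
  qed
qed

lemma fps_expansion_f_alpha:
  assumes "0 < a"
  shows "fps_nth (fps_expansion (f_alpha a) 0) n = complex_of_real (coeff_f a n)"
proof -
  define F where "F = fps_expansion (f_alpha a) 0"
  have F: "f_alpha a has_fps_expansion F"
    unfolding F_def by (rule has_fps_expansion_fps_expansion[OF _ _ f_alpha_holomorphic]) auto
  have "(\<lambda>z. deriv (f_alpha a) z * (1 - z ^ 2)) has_fps_expansion fps_deriv F * (1 - fps_X ^ 2)"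
    by (intro fps_expansion_intros F)
  moreover have "eventually (\<lambda>z. deriv (f_alpha a) z * (1 - z ^ 2) = 1 + 2 * complex_of_real a * f_alpha a z) (nhds 0)"
  proof -
    have "eventually (\<lambda>z::complex. z \<in> ball 0 1) (nhds 0)"
      by (intro eventually_nhds_in_open) auto
    thus ?thesis
    proof eventually_elim
      case (elim z)
      have "norm (z ^ 2) < 1"
        using elim by (simp add: norm_power power_less_one_iff abs_square_less_1)
      hence "1 - z ^ 2 \<noteq> 0" by auto
      thus ?case
        using DERIV_imp_deriv[OF f_alpha_has_field_derivative[OF elim \<open>0 < a\<close>]] by simp
    qed
  qed
  ultimately have "(\<lambda>z. 1 + 2 * complex_of_real a * f_alpha a z) has_fps_expansion fps_deriv F * (1 - fps_X ^ 2)"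
    by (rule has_fps_expansion_cong[THEN iffD1, rotated 2]) auto
  moreover have "(\<lambda>z. 1 + 2 * complex_of_real a * f_alpha a z) has_fps_expansion 1 + fps_const (2 * complex_of_real a) * F"
    by (intro fps_expansion_intros F)
  ultimately have eq: "fps_deriv F * (1 - fps_X ^ 2) = 1 + fps_const (2 * complex_of_real a) * F"
    by (rule fps_expansion_unique_complex)
  have F0: "fps_nth F 0 = 0"
    unfolding F_def by (simp add: fps_expansion_def f_alpha_def)
  have rec: "of_nat (k + 2) * fps_nth F (Suc (Suc k)) - of_nat k * fps_nth F k = 2 * a * fps_nth F (Suc k)" for k
    using arg_cong[OF eq, of "\<lambda>F. fps_nth F (Suc k)"] F0
    by (cases k) (simp_all add: algebra_simps fps_X_power_mult_right_nth numeral_2_eq_2)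
  have F1: "fps_nth F (Suc 0) = 1"
    using arg_cong[OF eq, of "\<lambda>F. fps_nth F 0"] F0 by (simp add: algebra_simps fps_X_power_mult_right_nth)
  have "fps_nth F n = complex_of_real (coeff_f a n)"
  proof (induction n rule: induct_nat_012)
    case (ge2 k)
    have "of_nat (k + 2) * fps_nth F (Suc (Suc k)) =
        complex_of_real (2 * a * coeff_f a (Suc k) + real k * coeff_f a k)"
      using rec[of k] ge2 by (simp add: algebra_simps)
    also have "\<dots> = of_nat (k + 2) * complex_of_real (coeff_f a (Suc (Suc k)))"
      unfolding coeff_f_Suc_Suc[symmetric] by (simp del: coeff_f.simps)
    finally have "of_nat (k + 2) * fps_nth F (Suc (Suc k)) = of_nat (k + 2) * complex_of_real (coeff_f a (Suc (Suc k)))" .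
    moreover have "of_nat (k + 2) \<noteq> (0 :: complex)"
      unfolding of_nat_eq_0_iff by simp
    ultimately show ?case
      by (metis mult_left_cancel)
  qed (simp_all add: F0 F1)
  thus ?thesis by (simp add: F_def)
qed

section \<open>Comparison with binomial coefficients\<close>

text \<open>
  The Taylor coefficients of \<open>((1 - z) powr (-a) - 1) / a\<close>, written so that \<open>a = 0\<close> is allowed as well:
  then they are \<open>1 / k\<close>, the coefficients of \<open>- ln (1 - z)\<close>.
\<close>
definition coeff_g :: "real \<Rightarrow> nat \<Rightarrow> real" where
  "coeff_g a k = (if k = 0 then 0 else pochhammer (1 + a) (k - 1) / fact k)"

lemma coeff_g_simps: "coeff_g a 0 = 0" "coeff_g a (Suc 0) = 1"
  by (simp_all add: coeff_g_def)

lemma coeff_g_Suc: "k > 0 \<Longrightarrow> coeff_g a (Suc k) = (real k + a) / (real k + 1) * coeff_g a k"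
  by (cases k) (simp_all add: coeff_g_def pochhammer_Suc field_simps)

lemma coeff_g_pos: "0 \<le> a \<Longrightarrow> 0 < k \<Longrightarrow> 0 < coeff_g a k"
  by (auto simp: coeff_g_def intro!: divide_pos_pos pochhammer_pos)

text \<open>
  The sequence \<open>coeff_g a\<close> has the same first term and is a supersolution of the recurrence of
  \<open>coeff_f a\<close>: where the recurrence expresses the term \<open>k + 1\<close> by the terms \<open>k\<close> and \<open>k - 1\<close>, the
  defect is \<open>a (1 - a) / k * coeff_g a (k - 1)\<close>.
\<close>
lemma coeff_f_le_coeff_g:
  assumes "0 \<le> a" "a \<le> 1"
  shows "coeff_f a k \<le> coeff_g a k"
proof -
  have "coeff_f a k \<le> coeff_g a k \<and> coeff_f a (Suc k) \<le> coeff_g a (Suc k)"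
  proof (induction k)
    case (Suc k)
    show ?case
    proof (cases k)
      case 0
      thus ?thesis using assms by (simp add: coeff_g_def field_simps)
    next
      case (Suc j)
      define g where "g = coeff_g a (Suc j)"
      have g: "g > 0" unfolding g_def by (intro coeff_g_pos) (use assms in auto)
      have "coeff_f a (Suc (Suc k)) * (real k + 2) = 2 * a * coeff_f a (Suc k) + real k * coeff_f a k"
        by (simp add: field_simps)
      also have "\<dots> \<le> 2 * a * coeff_g a (Suc k) + real k * coeff_g a k"
        using Suc.IH assms by (intro add_mono mult_left_mono) auto
      also have "\<dots> \<le> (real k + 2) * coeff_g a (Suc (Suc k))"
      proof -
        have "(real k + 2) * coeff_g a (Suc (Suc k)) - (2 * a * coeff_g a (Suc k) + real k * coeff_g a k)
            = a * (1 - a) * g / (real j + 2)"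
          unfolding Suc coeff_g_Suc[of "Suc (Suc j)" a, simplified] coeff_g_Suc[of "Suc j" a, simplified] g_def[symmetric]
          by (simp add: divide_simps) (simp add: algebra_simps)
        also have "\<dots> \<ge> 0"
          using assms g by simp
        finally show ?thesis by simp
      qed
      finally have "coeff_f a (Suc (Suc k)) \<le> coeff_g a (Suc (Suc k))"
        by (simp add: mult.commute[of "real k + 2"] del: coeff_f.simps)
      thus ?thesis using Suc.IH by simp
    qed
  qed (simp add: coeff_g_def)
  thus ?thesis ..
qed

text \<open>
  Shifting \<open>coeff_g a\<close> by one index and multiplying it by \<open>a\<close> turns it into a subsolution of the same
  recurrence. The factor \<open>a\<close> is forced by the start of the comparison, where \<open>coeff_f a 2 = a\<close>.
\<close>
lemma coeff_f_ge_coeff_g: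
  assumes "0 \<le> a" "a \<le> 1"
  shows "a * coeff_g a (Suc k) \<le> coeff_f a (Suc (Suc k))"
proof -
  have "a * coeff_g a (Suc k) \<le> coeff_f a (Suc (Suc k)) \<and>
    a * coeff_g a (Suc (Suc k)) \<le> coeff_f a (Suc (Suc (Suc k)))"
  proof (induction k)
    case 0
    have "(1 - a) * (2 - a) \<ge> 0" using assms by simp
    hence "2 + a * (4 * a) \<ge> 3 * (a + a * a)" by (simp add: algebra_simps)
    thus ?case by (simp add: coeff_g_def field_simps numeral_2_eq_2)
  next
    case (Suc k)
    define g where "g = coeff_g a (Suc k)"
    have g: "g > 0" unfolding g_def by (intro coeff_g_pos) (use assms in auto)
    have "(real k + 4) * (a * coeff_g a (Suc (Suc (Suc k)))) \<le>
        2 * a * (a * coeff_g a (Suc (Suc k))) + (real k + 2) * (a * coeff_g a (Suc k))"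
    proof -
      have "2 * a * (a * coeff_g a (Suc (Suc k))) + (real k + 2) * (a * coeff_g a (Suc k)) -
          (real k + 4) * (a * coeff_g a (Suc (Suc (Suc k)))) = a * (1 - a) * (2 - a) * g / (real k + 3)"
        unfolding coeff_g_Suc[of "Suc (Suc k)" a, simplified] coeff_g_Suc[of "Suc k" a, simplified] g_def[symmetric]
        by (simp add: divide_simps) (simp add: algebra_simps)
      also have "\<dots> \<ge> 0"
        using assms g by simp
      finally show ?thesis by simp
    qed
    also have "\<dots> \<le> 2 * a * coeff_f a (Suc (Suc (Suc k))) + (real k + 2) * coeff_f a (Suc (Suc k))"
      using Suc.IH assms by (intro add_mono mult_left_mono) auto
    also have "\<dots> = coeff_f a (Suc (Suc (Suc (Suc k)))) * (real k + 4)"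
      using coeff_f_Suc_Suc[of a "Suc (Suc k)"] by (simp add: add_ac del: coeff_f.simps)
    finally show ?case using Suc.IH by (simp add: mult.commute del: coeff_f.simps)
  qed
  thus ?thesis ..
qed

lemma powr_quotient_mult:
  fixes x y a :: real
  assumes "0 < x" "0 < y"
  shows "(x / y) powr (1 - a) * x powr (a - 1) = y powr (a - 1)"
proof -
  have *: "t powr (1 - a) * t powr (a - 1) = 1" if "0 < t" for t :: real
    using that by (simp flip: powr_add)
  have "(x / y) powr (1 - a) * x powr (a - 1) = x powr (1 - a) * x powr (a - 1) / y powr (1 - a)"
    using assms by (simp add: powr_divide)
  also have "\<dots> = y powr (a - 1)"
    unfolding *[OF assms(1)] using *[OF assms(2)] assms by (simp add: divide_eq_eq mult.commute)
  finally show ?thesis .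
qed

text \<open>
  The ratio of consecutive terms of \<open>coeff_g a\<close> is \<open>1 - (1 - a) / (k + 1)\<close>. The weighted inequality of
  the arithmetic and geometric means compares it with ratios of consecutive values of a power, from below
  and, applied to the reciprocal, from above.
\<close>
lemma coeff_g_ge_powr:
  assumes "0 \<le> a" "a \<le> 1" "0 < k"
  shows "real k powr (a - 1) \<le> coeff_g a k"
  using assms(3)
proof (induction k rule: nat_induct_non_zero)
  case (Suc k)
  have "(real k / (real k + 1)) powr (1 - a) * 1 powr a \<le> (1 - a) * (real k / (real k + 1)) + a * 1"
    using assms Suc.hyps by (intro Youngs_inequality_0) auto
  hence le: "(real k / (real k + 1)) powr (1 - a) \<le> (real k + a) / (real k + 1)"
    by (simp add: field_simps)
  have "real (Suc k) powr (a - 1) = (real k / (real k + 1)) powr (1 - a) * real k powr (a - 1)"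
    using Suc.hyps by (subst powr_quotient_mult) (simp_all add: add_ac)
  also have "\<dots> \<le> (real k + a) / (real k + 1) * coeff_g a k"
    using Suc le assms by (intro mult_mono) auto
  finally show ?case using Suc by (simp add: coeff_g_Suc)
qed (simp add: coeff_g_simps)

lemma coeff_g_le_powr:
  assumes "0 \<le> a" "a \<le> 1" "0 < k"
  shows "coeff_g a k \<le> 2 powr (1 - a) * real (Suc k) powr (a - 1)"
  using assms(3)
proof (induction k rule: nat_induct_non_zero)
  case 1
  show ?case by (simp add: coeff_g_simps powr_diff)
next
  case (Suc k)
  have "((real k + 2) / (real k + 1)) powr (1 - a) * 1 powr a \<le> (1 - a) * ((real k + 2) / (real k + 1)) + a * 1"
    using assms by (intro Youngs_inequality_0) auto
  hence "((real k + 2) / (real k + 1)) powr (1 - a) \<le> (real k + 2 - a) / (real k + 1)"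
    by (simp add: field_simps)
  also have "\<dots> \<le> (real k + 1) / (real k + a)"
  proof -
    have "(1 - a) ^ 2 \<ge> 0" by simp
    thus ?thesis using assms Suc.hyps by (simp add: field_simps power2_eq_square)
  qed
  finally have le: "(real k + a) / (real k + 1) \<le> ((real k + 1) / (real k + 2)) powr (1 - a)"
    using assms Suc.hyps by (simp add: powr_divide field_simps)
  have "coeff_g a (Suc k) = (real k + a) / (real k + 1) * coeff_g a k"
    using Suc by (simp add: coeff_g_Suc)
  also have "\<dots> \<le> ((real k + 1) / (real k + 2)) powr (1 - a) * (2 powr (1 - a) * real (Suc k) powr (a - 1))"
    using Suc le assms coeff_g_pos[of a k] by (intro mult_mono) auto
  also have "\<dots> = 2 powr (1 - a) * real (Suc (Suc k)) powr (a - 1)"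
    using powr_quotient_mult[of "real k + 1" "real k + 2" a] by (simp add: add_ac)
  finally show ?case .
qed

text \<open>
  The point of these bounds is that they are uniform in \<open>k\<close> and that both are \<open>1 + O(1 - a)\<close> as \<open>a\<close>
  tends to 1. They will provide the summable majorant for the infinite product.
\<close>
lemma coeff_f_powr_bounds:
  assumes "0 \<le> a" "a \<le> 1" "0 < k"
  shows "a \<le> coeff_f a k * real k powr (1 - a)" "coeff_f a k * real k powr (1 - a) \<le> 2 powr (1 - a)"
proof -
  have "coeff_f a k \<le> 2 powr (1 - a) * real (Suc k) powr (a - 1)"
    using coeff_f_le_coeff_g[of a k] coeff_g_le_powr[of a k] assms by linarith
  also have "\<dots> \<le> 2 powr (1 - a) * real k powr (a - 1)"
    using assms by (intro mult_left_mono powr_mono2') auto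
  finally show "coeff_f a k * real k powr (1 - a) \<le> 2 powr (1 - a)"
    using assms by (simp add: powr_diff field_simps)
  have "a * real k powr (a - 1) \<le> coeff_f a k"
  proof -
    consider "k = 1" | j where "k = Suc (Suc j)"
      using \<open>0 < k\<close> by (metis One_nat_def not0_implies_Suc less_numeral_extra(3))
    thus ?thesis
    proof cases
      case 2
      have "a * real k powr (a - 1) \<le> a * real (Suc j) powr (a - 1)"
        using assms 2 by (intro mult_left_mono powr_mono2') auto
      also have "\<dots> \<le> a * coeff_g a (Suc j)"
        using assms by (intro mult_left_mono coeff_g_ge_powr) auto
      also have "\<dots> \<le> coeff_f a k"
        unfolding 2 by (rule coeff_f_ge_coeff_g) (use assms in auto)
      finally show ?thesis .
    qed (use assms in auto)
  qed
  thus "a \<le> coeff_f a k * real k powr (1 - a)"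
    using assms by (simp add: powr_diff field_simps)
qed

section \<open>Abelian comparison of power series\<close>

text \<open>
  If the denominator tends to infinity, then any finite number of its coefficients becomes negligible, so the
  quotient of the two functions inherits the limit of the quotients of the coefficients.
\<close>
lemma power_series_ratio_at_left_1:
  fixes a b :: "nat \<Rightarrow> real"
  assumes a: "\<And>r. 0 < r \<Longrightarrow> r < 1 \<Longrightarrow> (\<lambda>k. a k * r ^ k) sums f r"
    and b: "\<And>r. 0 < r \<Longrightarrow> r < 1 \<Longrightarrow> (\<lambda>k. b k * r ^ k) sums g r"
    and b_pos: "eventually (\<lambda>k. 0 < b k) sequentially" and b_nonneg: "\<And>k. 0 \<le> b k"
    and lim: "(\<lambda>k. a k / b k) \<longlonglongrightarrow> L"
    and top: "filterlim g at_top (at_left 1)"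
  shows "((\<lambda>r. f r / g r) \<longlongrightarrow> L) (at_left 1)"
proof (rule tendstoI)
  fix e :: real
  assume "0 < e"
  have "eventually (\<lambda>k. \<bar>a k - L * b k\<bar> \<le> e / 2 * b k) sequentially"
    using tendstoD[OF lim half_gt_zero[OF \<open>0 < e\<close>]] b_pos
  proof eventually_elim
    case (elim k)
    thus ?case using \<open>0 < e\<close>
      by (simp add: dist_real_def abs_le_iff abs_less_iff field_simps)
  qed
  then obtain N where N: "\<And>k. k \<ge> N \<Longrightarrow> \<bar>a k - L * b k\<bar> \<le> e / 2 * b k"
    unfolding eventually_sequentially by blast
  \<comment> \<open>The first \<open>N\<close> terms contribute at most the constant \<open>K\<close>, which is less than \<open>e / 2 * g r\<close> near 1.\<close>
  define K where "K = (\<Sum>k<N. \<bar>a k - L * b k\<bar>)"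
  have "eventually (\<lambda>r. g r > max 0 (2 * K / e)) (at_left 1)"
    using top unfolding filterlim_at_top_dense by blast
  moreover have "eventually (\<lambda>r::real. r \<in> {0<..<1}) (at_left 1)"
    by (rule eventually_at_leftI) auto
  ultimately show "eventually (\<lambda>r. dist (f r / g r) L < e) (at_left 1)"
  proof eventually_elim
    case (elim r)
    hence r: "0 < r" "r < 1" and g: "g r > 0" "g r > 2 * K / e" by auto
    have diff: "(\<lambda>k. (a k - L * b k) * r ^ k) sums (f r - L * g r)"
      using sums_diff[OF a[OF r] sums_mult[OF b[OF r], of L]] by (simp add: algebra_simps)
    have major: "(\<lambda>k. (if k < N then \<bar>a k - L * b k\<bar> else 0) + e / 2 * (b k * r ^ k)) sums (K + e / 2 * g r)"
    proof (intro sums_add sums_mult b[OF r])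
      have "(\<lambda>k. if k \<in> {..<N} then \<bar>a k - L * b k\<bar> else 0) sums K"
        unfolding K_def by (rule sums_If_finite_set) auto
      thus "(\<lambda>k. if k < N then \<bar>a k - L * b k\<bar> else 0) sums K" by simp
    qed
    have le: "norm ((a k - L * b k) * r ^ k) \<le> (if k < N then \<bar>a k - L * b k\<bar> else 0) + e / 2 * (b k * r ^ k)" for k
    proof (cases "k < N")
      case True
      have "\<bar>a k - L * b k\<bar> * r ^ k \<le> \<bar>a k - L * b k\<bar> * 1"
        using r by (intro mult_left_mono power_le_one) auto
      moreover have "0 \<le> e / 2 * (b k * r ^ k)"
        using \<open>0 < e\<close> b_nonneg r by simp
      ultimately show ?thesis using True r by (simp add: abs_mult)
    next
      case False
      thus ?thesis
        using mult_right_mono[OF N[of k], of "r ^ k"] r by (simp add: abs_mult mult.assoc)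
    qed
    have "norm (\<Sum>k. (a k - L * b k) * r ^ k) \<le>
        (\<Sum>k. (if k < N then \<bar>a k - L * b k\<bar> else 0) + e / 2 * (b k * r ^ k))"
      by (rule norm_suminf_le[OF le sums_summable[OF major]])
    hence "\<bar>f r - L * g r\<bar> \<le> K + e / 2 * g r"
      unfolding sums_unique[OF diff, symmetric] sums_unique[OF major, symmetric] by simp
    also have "\<dots> < e * g r"
      using g \<open>0 < e\<close> by (simp add: field_simps)
    finally show ?case
      using g by (simp add: dist_real_def abs_less_iff field_simps)
  qed
qed

lemma coeff_g_sums:
  assumes "0 < a" "\<bar>r\<bar> < 1"
  shows "(\<lambda>k. coeff_g a k * r ^ k) sums (((1 - r) powr (-a) - 1) / a)"
proof -
  have "(\<lambda>k. (-a gchoose k) * (-r) ^ k) sums (1 + -r) powr (-a)"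
    by (rule gen_binomial_real) (use assms in auto)
  moreover have "(-a gchoose k) * (-r) ^ k = pochhammer a k / fact k * r ^ k" for k
    by (simp add: gbinomial_pochhammer power_minus[of r])
  ultimately have "(\<lambda>k. pochhammer a k / fact k * r ^ k) sums (1 - r) powr (-a)"
    by simp
  moreover have "(\<lambda>k. if k = 0 then 1 else (0::real)) sums 1"
    using sums_If_finite_set[of "{0}" "\<lambda>_. 1::real"] by simp
  ultimately have "(\<lambda>k. (pochhammer a k / fact k * r ^ k - (if k = 0 then 1 else 0)) / a) sums
      (((1 - r) powr (-a) - 1) / a)"
    by (intro sums_divide sums_diff)
  moreover have "(pochhammer a k / fact k * r ^ k - (if k = 0 then 1 else 0)) / a = coeff_g a k * r ^ k" for k
    using assms(1) by (cases k) (auto simp: coeff_g_def pochhammer_rec add.commute)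
  ultimately show ?thesis by simp
qed

lemma power_series_at_left_1_of_ratio:
  fixes c :: "nat \<Rightarrow> real"
  assumes F: "\<And>r. 0 < r \<Longrightarrow> r < 1 \<Longrightarrow> (\<lambda>k. c k * r ^ k) sums F r"
    and a: "0 < a" and lim: "(\<lambda>k. c k / coeff_g a k) \<longlonglongrightarrow> L"
  shows "((\<lambda>r. (1 - r) powr a * F r) \<longlongrightarrow> L / a) (at_left 1)"
proof -
  define G where "G r = ((1 - r) powr (-a) - 1) / a" for r :: real
  have "((\<lambda>r. F r / G r) \<longlongrightarrow> L) (at_left 1)"
  proof (rule power_series_ratio_at_left_1[where a = c and b = "coeff_g a", OF F])
    show "(\<lambda>k. coeff_g a k * r ^ k) sums G r" if "0 < r" "r < 1" for r
      unfolding G_def using a that by (intro coeff_g_sums) auto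
    show "eventually (\<lambda>k. 0 < coeff_g a k) sequentially"
      using eventually_gt_at_top[of 0] by eventually_elim (use a in \<open>auto intro: coeff_g_pos\<close>)
    show "0 \<le> coeff_g a k" for k
      using coeff_g_pos[of a k] a by (cases k) (auto simp: coeff_g_simps)
    show "filterlim G at_top (at_left 1)"
      unfolding G_def using a by real_asymp
  qed (use lim in auto)
  moreover have "((\<lambda>r. (1 - (1 - r) powr a) / a) \<longlongrightarrow> 1 / a) (at_left (1::real))"
  proof -
    have "((\<lambda>r::real. (1 - r) powr a) \<longlongrightarrow> 0) (at_left 1)"
      using a by real_asymp
    from tendsto_divide[OF tendsto_diff[OF tendsto_const this] tendsto_const, of a 1] a
    show ?thesis by simp
  qed
  ultimately have "((\<lambda>r. F r / G r * ((1 - (1 - r) powr a) / a)) \<longlongrightarrow> L * (1 / a)) (at_left 1)"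
    by (rule tendsto_mult)
  moreover have "eventually (\<lambda>r. F r / G r * ((1 - (1 - r) powr a) / a) = (1 - r) powr a * F r) (at_left 1)"
  proof -
    have "eventually (\<lambda>r::real. r \<in> {0<..<1}) (at_left 1)"
      by (rule eventually_at_leftI) auto
    thus ?thesis
    proof eventually_elim
      case (elim r)
      have "(1 - r) powr a < 1" using a elim powr_less_mono2[of a "1 - r" 1] by simp
      moreover have "(1 - r) powr a > 0" using elim by simp
      ultimately show ?case
        unfolding G_def using a elim by (simp add: powr_minus_divide divide_simps)
    qed
  qed
  ultimately show ?thesis
    by (simp add: Lim_transform_eventually)
qed

text \<open>This is Euler's limit formula for the Gamma function, read as a statement about binomial coefficients.\<close>
lemma coeff_g_asymp:
  assumes "0 < a"
  shows "(\<lambda>k. coeff_g a k * real k powr (1 - a)) \<longlonglongrightarrow> 1 / Gamma (1 + a)"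
proof -
  have "(\<lambda>k. 1 / (a * Gamma_series' a k)) \<longlonglongrightarrow> 1 / (a * Gamma a)"
    using assms by (intro tendsto_intros Gamma_series'_LIMSEQ) (auto simp: Gamma_eq_zero_iff nonpos_Ints_def)
  also have "a * Gamma a = Gamma (1 + a)"
    using assms by (subst add.commute, subst Gamma_plus1) auto
  finally show ?thesis
  proof (rule Lim_transform_eventually)
    show "eventually (\<lambda>k. 1 / (a * Gamma_series' a k) = coeff_g a k * real k powr (1 - a)) sequentially"
      using eventually_gt_at_top[of 0]
    proof eventually_elim
      case (elim k)
      then obtain j where k: "k = Suc j" by (cases k) auto
      show ?case
        using assms unfolding k
        by (simp add: Gamma_series'_def coeff_g_def pochhammer_rec powr_def powr_diff exp_diff add.commute divide_simps)
           (simp add: algebra_simps flip: exp_add)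
    qed
  qed
qed

section \<open>Exact asymptotics of the coefficients of one factor\<close>

text \<open>
  The recursion \<open>v (k + 1) \<le> (1 - p k) v k + e k\<close> with \<open>p\<close> not summable and \<open>e\<close> summable forces \<open>v\<close> to 0.
  The errors enter through their tails \<open>q\<close>, so \<open>e k = q k - q (k + 1)\<close>: then \<open>v + q\<close> decreases, and its
  total decrease bounds the sum of the \<open>p k v k\<close>, which would diverge if \<open>v\<close> had a positive limit.
\<close>
lemma tendsto_0_of_contraction_nonsummable:
  fixes v p q :: "nat \<Rightarrow> real"
  assumes v: "\<And>k. 0 \<le> v k" and p: "\<And>k. 0 \<le> p k" and q: "\<And>k. 0 \<le> q k" "q \<longlonglongrightarrow> 0"
    and step: "\<And>k. v (Suc k) + q (Suc k) \<le> v k + q k - p k * v k"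
    and p_div: "\<not> summable p"
  shows "v \<longlonglongrightarrow> 0"
proof -
  define w where "w k = v k + q k" for k
  have w_nonneg: "w k \<ge> 0" for k using v q by (simp add: w_def)
  have w_step: "w (Suc k) + p k * v k \<le> w k" for k
    using step[of k] by (simp add: w_def)
  have "decseq w"
    using w_step v p by (intro decseq_SucI) (smt (verit) mult_nonneg_nonneg)
  then obtain d where d: "w \<longlonglongrightarrow> d"
    using decseq_convergent[of w 0] w_nonneg by blast
  have "v \<longlonglongrightarrow> d"
    using tendsto_diff[OF d q(2)] by (simp add: w_def)
  have "d \<ge> 0"
    using LIMSEQ_le_const[OF d] w_nonneg by blast
  have "d = 0"
  proof (rule ccontr)
    assume "d \<noteq> 0"
    with \<open>d \<ge> 0\<close> have "d > 0" by simp
    have sum_le: "(\<Sum>k<n. p k * v k) \<le> w 0 - w n" for n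
    proof (induction n)
      case (Suc n)
      show ?case using Suc.IH w_step[of n] by simp
    qed simp
    have "summable (\<lambda>k. p k * v k)"
      by (rule summableI_nonneg_bounded[of _ "w 0"])
         (use v p sum_le w_nonneg in \<open>auto intro: order.trans simp: algebra_simps\<close>, smt (verit, best))
    hence summable: "summable (\<lambda>k. 2 / d * (p k * v k))" by (rule summable_mult)
    have half: "d / 2 < d" using \<open>d > 0\<close> by simp
    have "eventually (\<lambda>k. norm (p k) \<le> 2 / d * (p k * v k)) sequentially"
      using order_tendstoD(1)[OF \<open>v \<longlonglongrightarrow> d\<close> half]
    proof eventually_elim
      case (elim k)
      hence "p k * (d / 2) \<le> p k * v k" using p by (intro mult_left_mono) auto
      thus ?case using \<open>d > 0\<close> p[of k] by (simp add: field_simps)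
    qed
    from this summable have "summable p"
      by (rule summable_comparison_test_ev)
    thus False using p_div by simp
  qed
  thus ?thesis using \<open>v \<longlonglongrightarrow> d\<close> by simp
qed

text \<open>
  Dividing the recurrence of \<open>coeff_f\<close> by \<open>coeff_g\<close> makes each new quotient an average of the two preceding
  quotients, up to a summable error of the favourable sign. Therefore the maximum of two consecutive quotients
  decreases, hence converges. The weight of the more recent quotient tends to 0 like \<open>2 a / k\<close>, so the quotients
  could a priori oscillate between two values. Since these weights have a divergent sum, the previous
  lemma excludes this.
\<close>
lemma convergent_coeff_ratio:
  assumes a: "0 < a" "a \<le> 1"
  shows "convergent (\<lambda>k. coeff_f a k / coeff_g a k)"
proof -
  define R where "R k = coeff_f a (Suc k) / coeff_g a (Suc k)" for k
  have rec: "(real k + 2 + a) * R (Suc (Suc k)) =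
      2 * a * R (Suc k) + (real k + 2) * (real k + 1) / (real k + 1 + a) * R k" for k
  proof -
    define g where "g = coeff_g a (Suc k)"
    have g: "g > 0" unfolding g_def using a by (intro coeff_g_pos) auto
    define x where "x = real k"
    have x: "x \<ge> 0" by (simp add: x_def)
    define f1 f2 where "f1 = coeff_f a (Suc (Suc k))" and "f2 = coeff_f a (Suc k)"
    have f3: "coeff_f a (Suc (Suc (Suc k))) = (2 * a * f1 + (x + 1) * f2) / (x + 3)"
      by (simp add: f1_def f2_def x_def add_ac)
    have g2: "coeff_g a (Suc (Suc k)) = (x + 1 + a) / (x + 2) * g"
      by (subst coeff_g_Suc) (simp_all add: g_def x_def add_ac)
    have g3: "coeff_g a (Suc (Suc (Suc k))) = (x + 2 + a) / (x + 3) * ((x + 1 + a) / (x + 2) * g)"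
      by (subst coeff_g_Suc) (simp_all add: g2 x_def add_ac)
    show ?thesis
      unfolding R_def f3 g3 g2 f1_def[symmetric] f2_def[symmetric] g_def[symmetric] x_def[symmetric]
      using g a x by (simp add: divide_simps) (simp add: algebra_simps)?
  qed
  have R_nonneg: "0 \<le> R k" for k
    unfolding R_def using a coeff_g_pos[of a "Suc k"] by (intro divide_nonneg_nonneg coeff_f_nonneg) auto
  have R_le_1: "R k \<le> 1" for k
    unfolding R_def using coeff_f_le_coeff_g[of a "Suc k"] coeff_g_pos[of a "Suc k"] a by simp
  define M where "M k = max (R (Suc k)) (R k)" for k
  define v where "v k = \<bar>R (Suc k) - R k\<bar>" for k
  define q where "q k = a * (1 - a) / (real k + 1 + a)" for k
  define p where "p k = 2 * a / (real k + 2 + a)" for k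
  \<comment> \<open>The weights sum to one up to \<open>q k - q (Suc k) = a (1 - a) / ((k + 1 + a) (k + 2 + a))\<close>, which telescopes.\<close>
  have step: "R (Suc (Suc k)) = p k * R (Suc k) + (1 - p k - (q k - q (Suc k))) * R k" for k
  proof -
    have "R (Suc (Suc k)) = ((real k + 2 + a) * R (Suc (Suc k))) / (real k + 2 + a)"
      using a by (simp add: field_simps)
    also have "\<dots> = (2 * a * R (Suc k) + (real k + 2) * (real k + 1) / (real k + 1 + a) * R k) / (real k + 2 + a)"
      unfolding rec ..
    also have "\<dots> = p k * R (Suc k) + (1 - p k - (q k - q (Suc k))) * R k"
      unfolding p_def q_def using a by (simp add: divide_simps) (simp add: algebra_simps)
    finally show ?thesis .
  qed
  have q_nonneg: "0 \<le> q k" and p_nonneg: "0 \<le> p k" and p_le: "p k \<le> 1" for k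
    using a by (auto simp: q_def p_def)
  have q_dec: "q (Suc k) \<le> q k" for k
    unfolding q_def using a by (intro divide_left_mono) auto
  have M_step: "M (Suc k) \<le> M k" for k
  proof -
    have "R (Suc (Suc k)) \<le> p k * R (Suc k) + (1 - p k) * R k"
      unfolding step using q_dec[of k] R_nonneg[of k] by (intro add_left_mono mult_right_mono) auto
    also have "\<dots> \<le> p k * M k + (1 - p k) * M k"
      using p_nonneg[of k] p_le[of k] by (intro add_mono mult_left_mono) (auto simp: M_def)
    also have "\<dots> = M k" by (simp add: algebra_simps)
    finally show ?thesis by (simp add: M_def)
  qed
  have "v \<longlonglongrightarrow> 0"
  proof (rule tendsto_0_of_contraction_nonsummable[where p = p and q = q])
    fix k
    have "R (Suc (Suc k)) - R (Suc k) = - ((1 - p k) * (R (Suc k) - R k)) - (q k - q (Suc k)) * R k"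
      unfolding step by (simp add: algebra_simps)
    hence "v (Suc k) \<le> \<bar>(1 - p k) * (R (Suc k) - R k)\<bar> + \<bar>(q k - q (Suc k)) * R k\<bar>"
      unfolding v_def by linarith
    also have "\<dots> = (1 - p k) * v k + (q k - q (Suc k)) * R k"
      using p_le[of k] q_dec[of k] R_nonneg[of k] by (simp add: abs_mult v_def)
    also have "\<dots> \<le> (1 - p k) * v k + (q k - q (Suc k)) * 1"
      using R_le_1 q_dec by (intro add_left_mono mult_left_mono) auto
    finally show "v (Suc k) + q (Suc k) \<le> v k + q k - p k * v k"
      by (simp add: algebra_simps)
  next
    show "q \<longlonglongrightarrow> 0" unfolding q_def by real_asymp
  next
    show "\<not> summable p"
    proof
      assume "summable p"
      hence "summable (\<lambda>k. 3 / (2 * a) * p k)" by (rule summable_mult)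
      moreover have "\<forall>k\<ge>0. norm (1 / (real (Suc k))) \<le> 3 / (2 * a) * p k"
        using a by (simp add: p_def divide_simps)
      ultimately have "summable (\<lambda>k. 1 / real (Suc k))"
        by (rule summable_comparison_test[OF exI, rotated])
      thus False
        using not_summable_harmonic[where 'a = real] summable_Suc_iff[of "\<lambda>k. 1 / real k"]
        by (simp add: inverse_eq_divide)
    qed
  qed (use q_nonneg p_nonneg in \<open>auto simp: v_def\<close>)
  have "decseq M"
    using M_step by (intro decseq_SucI)
  moreover have "0 \<le> M k" for k using R_nonneg[of k] by (simp add: M_def le_max_iff_disj)
  ultimately obtain L where "M \<longlonglongrightarrow> L"
    using decseq_convergent[of M 0] by blast
  have "R \<longlonglongrightarrow> L"
  proof (rule tendsto_sandwich)
    show "(\<lambda>k. M k - v k) \<longlonglongrightarrow> L"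
      using tendsto_diff[OF \<open>M \<longlonglongrightarrow> L\<close> \<open>v \<longlonglongrightarrow> 0\<close>] by simp
    have "M k - v k \<le> R k" "R k \<le> M k" for k
      unfolding M_def v_def by linarith+
    thus "eventually (\<lambda>k. M k - v k \<le> R k) sequentially" "eventually (\<lambda>k. R k \<le> M k) sequentially"
      by auto
  qed fact
  hence "(\<lambda>k. coeff_f a k / coeff_g a k) \<longlonglongrightarrow> L"
    unfolding R_def by (rule LIMSEQ_imp_Suc[of "\<lambda>k. coeff_f a k / coeff_g a k"])
  thus ?thesis by (auto simp: convergent_def)
qed

lemma f_alpha_sums:
  assumes "0 < a" "z \<in> ball 0 1"
  shows "(\<lambda>k. complex_of_real (coeff_f a k) * z ^ k) sums f_alpha a z"
  using holomorphic_power_series[OF f_alpha_holomorphic[of a] assms(2)]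
    fps_expansion_f_alpha[OF assms(1)]
  by (simp only: fps_expansion_def fps_nth_Abs_fps diff_zero)

text \<open>
  Once the limit \<open>L\<close> is known to exist, its value can be read off from the generating functions:
  \<open>(1 - r) powr a * f_alpha a r\<close> tends to \<open>L / a\<close> by the Abelian comparison and to \<open>2 powr a / (2 * a)\<close> by
  the explicit formula.
\<close>
lemma coeff_ratio_limit:
  assumes a: "0 < a" "a \<le> 1"
  shows "(\<lambda>k. coeff_f a k / coeff_g a k) \<longlonglongrightarrow> 2 powr (a - 1)"
proof -
  obtain L where L: "(\<lambda>k. coeff_f a k / coeff_g a k) \<longlonglongrightarrow> L"
    using convergent_coeff_ratio[OF a] by (auto simp: convergent_def)
  define F where "F r = (((1 + r) / (1 - r)) powr a - 1) / (2 * a)" for r :: real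
  have "((\<lambda>r. (1 - r) powr a * F r) \<longlongrightarrow> L / a) (at_left 1)"
  proof (rule power_series_at_left_1_of_ratio[OF _ a(1) L])
    fix r :: real assume r: "0 < r" "r < 1"
    have "complex_of_real (F r) = f_alpha a (of_real r)"
    proof -
      have "(1 + of_real r) / (1 - of_real r) = complex_of_real ((1 + r) / (1 - r))" by simp
      moreover have "complex_of_real ((1 + r) / (1 - r)) powr of_real a = of_real (((1 + r) / (1 - r)) powr a)"
        using r by (intro powr_of_real) auto
      ultimately show ?thesis unfolding f_alpha_def F_def by simp
    qed
    moreover have "(\<lambda>k. complex_of_real (coeff_f a k) * of_real r ^ k) sums f_alpha a (of_real r)"
      using a r by (intro f_alpha_sums) auto
    ultimately have "(\<lambda>k. complex_of_real (coeff_f a k * r ^ k)) sums complex_of_real (F r)"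
      by simp
    thus "(\<lambda>k. coeff_f a k * r ^ k) sums F r"
      unfolding sums_of_real_iff .
  qed
  moreover have "((\<lambda>r. (1 - r) powr a * F r) \<longlongrightarrow> 2 powr a / (2 * a)) (at_left 1)"
  proof -
    have "((\<lambda>r. (1 + r) powr a - (1 - r) powr a) \<longlongrightarrow> 2 powr a) (at_left (1::real))"
      using a by real_asymp
    hence "((\<lambda>r. ((1 + r) powr a - (1 - r) powr a) / (2 * a)) \<longlongrightarrow> 2 powr a / (2 * a)) (at_left 1)"
      using a by (intro tendsto_divide tendsto_const) auto
    moreover have "eventually (\<lambda>r::real. r \<in> {0<..<1}) (at_left 1)"
      by (rule eventually_at_leftI) auto
    hence "eventually (\<lambda>r. ((1 + r) powr a - (1 - r) powr a) / (2 * a) = (1 - r) powr a * F r) (at_left 1)"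
    proof eventually_elim
      case (elim r)
      thus ?case
        unfolding F_def using a by (simp add: powr_divide) (simp add: divide_simps)
    qed
    ultimately show ?thesis
      by (rule Lim_transform_eventually)
  qed
  ultimately have "L / a = 2 powr a / (2 * a)"
    by (rule tendsto_unique[rotated]) auto
  hence "L / a * a = 2 powr a / (2 * a) * a"
    by simp
  hence "L = 2 powr (a - 1)"
    using a by (simp add: powr_diff)
  thus ?thesis using L by simp
qed

lemma coeff_f_asymp:
  assumes "0 < a" "a \<le> 1"
  shows "(\<lambda>k. coeff_f a k * real k powr (1 - a)) \<longlonglongrightarrow> 2 powr (a - 1) / Gamma (a + 1)"
proof -
  have "(\<lambda>k. coeff_f a k / coeff_g a k * (coeff_g a k * real k powr (1 - a))) \<longlonglongrightarrow> 2 powr (a - 1) * (1 / Gamma (1 + a))"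
    using assms by (intro tendsto_mult coeff_ratio_limit coeff_g_asymp) auto
  moreover have "eventually (\<lambda>k. coeff_f a k / coeff_g a k * (coeff_g a k * real k powr (1 - a)) =
      coeff_f a k * real k powr (1 - a)) sequentially"
    using eventually_gt_at_top[of 0]
  proof eventually_elim
    case (elim k)
    thus ?case using coeff_g_pos[of a k] assms by simp
  qed
  ultimately have "(\<lambda>k. coeff_f a k * real k powr (1 - a)) \<longlonglongrightarrow> 2 powr (a - 1) * (1 / Gamma (1 + a))"
    by (rule Lim_transform_eventually)
  thus ?thesis
    by (simp add: add.commute)
qed

section \<open>The limit of the convolutions\<close>

lemma has_fps_expansion_sums_ball:
  fixes f :: "complex \<Rightarrow> complex"
  assumes "\<And>z. z \<in> ball 0 1 \<Longrightarrow> (\<lambda>k. c k * z ^ k) sums f z"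
  shows "f has_fps_expansion Abs_fps c"
proof (rule has_fps_expansionI)
  have "eventually (\<lambda>z::complex. z \<in> ball 0 1) (nhds 0)"
    by (intro eventually_nhds_in_open) auto
  thus "eventually (\<lambda>z. (\<lambda>n. fps_nth (Abs_fps c) n * z ^ n) sums f z) (nhds 0)"
    by eventually_elim (use assms in auto)
qed

lemma summable_bounded_coeffs:
  fixes c :: "nat \<Rightarrow> 'a :: {real_normed_field, banach}"
  assumes "\<And>k. norm (c k) \<le> 1" "norm z < 1"
  shows "summable (\<lambda>k. c k * z ^ k)"
proof (rule summable_comparison_test'[of "\<lambda>k. norm z ^ k" 0])
  show "summable (\<lambda>k. norm z ^ k)" using assms by (intro summable_geometric) auto
  show "norm (c k * z ^ k) \<le> norm z ^ k" for k
    using mult_right_mono[OF assms(1)[of k], of "norm z ^ k"] by (simp add: norm_mult norm_power)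
qed

definition conv_coeff :: "(nat \<Rightarrow> real) \<Rightarrow> nat \<Rightarrow> nat \<Rightarrow> real" where
  "conv_coeff \<alpha> n k = (\<Prod>i\<le>n. coeff_f (\<alpha> i) k)"

definition limit_coeff :: "(nat \<Rightarrow> real) \<Rightarrow> nat \<Rightarrow> real" where
  "limit_coeff \<alpha> k = lim (\<lambda>n. conv_coeff \<alpha> n k)"

context
  fixes \<alpha> :: "nat \<Rightarrow> real"
  assumes alpha: "\<And>n. 0 < \<alpha> n \<and> \<alpha> n \<le> 1"
begin

lemma alpha_bounds: "0 \<le> \<alpha> n" "\<alpha> n \<le> 1"
  using alpha[of n] by auto

lemma conv_coeff_nonneg: "0 \<le> conv_coeff \<alpha> n k"
  unfolding conv_coeff_def by (intro prod_nonneg ballI coeff_f_nonneg alpha_bounds)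

lemma conv_coeff_Suc_le: "conv_coeff \<alpha> (Suc n) k \<le> conv_coeff \<alpha> n k"
  using mult_left_mono[OF coeff_f_le_1[OF alpha_bounds, of "Suc n" k] conv_coeff_nonneg[of n k]]
  by (simp add: conv_coeff_def)

lemma conv_coeff_le_1: "conv_coeff \<alpha> n k \<le> 1"
  unfolding conv_coeff_def by (intro prod_le_1 conjI coeff_f_nonneg coeff_f_le_1 alpha_bounds)

lemma conv_coeff_tendsto: "(\<lambda>n. conv_coeff \<alpha> n k) \<longlonglongrightarrow> limit_coeff \<alpha> k"
proof -
  have "decseq (\<lambda>n. conv_coeff \<alpha> n k)"
    using conv_coeff_Suc_le by (intro decseq_SucI)
  then obtain L where "(\<lambda>n. conv_coeff \<alpha> n k) \<longlonglongrightarrow> L"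
    by (rule decseq_convergent[of _ 0]) (use conv_coeff_nonneg in auto)
  thus ?thesis unfolding limit_coeff_def by (simp add: limI)
qed

lemma limit_coeff_le: "limit_coeff \<alpha> k \<le> conv_coeff \<alpha> n k"
  by (rule decseq_ge[OF decseq_SucI conv_coeff_tendsto]) (rule conv_coeff_Suc_le)

lemma limit_coeff_nonneg: "0 \<le> limit_coeff \<alpha> k"
  by (rule LIMSEQ_le_const[OF conv_coeff_tendsto]) (use conv_coeff_nonneg in auto)

lemma limit_coeff_le_1: "limit_coeff \<alpha> k \<le> 1"
  using limit_coeff_le[of k 0] conv_coeff_le_1[of 0 k] by simp

lemma conv_f_sums:
  assumes "z \<in> ball 0 1"
  shows "(\<lambda>k. complex_of_real (conv_coeff \<alpha> n k) * z ^ k) sums conv_f \<alpha> n z"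
  using assms
proof (induction n arbitrary: z)
  case 0
  thus ?case using f_alpha_sums[of "\<alpha> 0" z] alpha[of 0] by (simp add: conv_coeff_def)
next
  case (Suc n)
  have "fps_expansion (conv_f \<alpha> n) 0 = Abs_fps (\<lambda>k. complex_of_real (conv_coeff \<alpha> n k))"
    by (intro fps_expansion_eqI has_fps_expansion_sums_ball Suc.IH)
  hence "fps_nth (fps_expansion (conv_f \<alpha> n) 0) k * fps_nth (fps_expansion (f_alpha (\<alpha> (Suc n))) 0) k
      = complex_of_real (conv_coeff \<alpha> (Suc n) k)" for k
    using alpha[of "Suc n"] by (simp add: fps_expansion_f_alpha conv_coeff_def mult.commute)
  hence "conv_f \<alpha> (Suc n) z = (\<Sum>k. complex_of_real (conv_coeff \<alpha> (Suc n) k) * z ^ k)"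
    by (simp add: hadamard_def)
  moreover have "summable (\<lambda>k. complex_of_real (conv_coeff \<alpha> (Suc n) k) * z ^ k)"
    using Suc.prems conv_coeff_nonneg conv_coeff_le_1 by (intro summable_bounded_coeffs) auto
  ultimately show ?case by (simp add: sums_iff)
qed

text \<open>
  On a disk of radius \<open>r < 1\<close> the distance to the limit is at most
  \<open>\<Sum>k. \<bar>conv_coeff \<alpha> n k - limit_coeff \<alpha> k\<bar> * r ^ k\<close>, where each term tends to 0 and is at most \<open>r ^ k\<close>.
\<close>
lemma loc_unif_limit_exists:
  "loc_unif_limit_disk (conv_f \<alpha>) (\<lambda>z. \<Sum>k. complex_of_real (limit_coeff \<alpha> k) * z ^ k)"
  unfolding loc_unif_limit_disk_def
proof (intro allI impI, elim conjE)
  fix K :: "complex set"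
  assume K: "compact K" "K \<subseteq> ball 0 1"
  define f where "f z = (\<Sum>k. complex_of_real (limit_coeff \<alpha> k) * z ^ k)" for z
  obtain r where r: "0 \<le> r" "r < 1" "\<And>z. z \<in> K \<Longrightarrow> norm z \<le> r"
  proof (cases "K = {}")
    case False
    then obtain w where "w \<in> K" "\<And>z. z \<in> K \<Longrightarrow> norm z \<le> norm w"
      using continuous_attains_sup[OF K(1) _ continuous_on_norm_id] by metis
    thus ?thesis using K(2) by (intro that[of "norm w"]) auto
  qed (use that[of 0] in auto)
  define \<delta> where "\<delta> n = (\<Sum>k. \<bar>conv_coeff \<alpha> n k - limit_coeff \<alpha> k\<bar> * r ^ k)" for n
  have diff_le: "\<bar>conv_coeff \<alpha> n k - limit_coeff \<alpha> k\<bar> \<le> 1" for n k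
    using conv_coeff_le_1[of n k] limit_coeff_nonneg[of k] limit_coeff_le[of k n] by simp
  have "(\<lambda>n. \<Sum>k. \<bar>conv_coeff \<alpha> n k - limit_coeff \<alpha> k\<bar> * r ^ k) \<longlonglongrightarrow> (\<Sum>k. 0)"
  proof (rule tannerys_theorem[THEN conjunct2, THEN conjunct2])
    show "(\<lambda>n. \<bar>conv_coeff \<alpha> n k - limit_coeff \<alpha> k\<bar> * r ^ k) \<longlonglongrightarrow> 0" for k
    proof -
      have "(\<lambda>n. \<bar>conv_coeff \<alpha> n k - limit_coeff \<alpha> k\<bar> * r ^ k) \<longlonglongrightarrow> \<bar>limit_coeff \<alpha> k - limit_coeff \<alpha> k\<bar> * r ^ k"
        by (intro tendsto_intros conv_coeff_tendsto)
      thus ?thesis by simp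
    qed
    show "summable (\<lambda>k. r ^ k)" using r by (intro summable_geometric) auto
    show "eventually (\<lambda>(k, n). norm (\<bar>conv_coeff \<alpha> n k - limit_coeff \<alpha> k\<bar> * r ^ k) \<le> r ^ k)
        (sequentially \<times>\<^sub>F sequentially)"
    proof (intro always_eventually allI, clarify)
      fix k n
      show "norm (\<bar>conv_coeff \<alpha> n k - limit_coeff \<alpha> k\<bar> * r ^ k) \<le> r ^ k"
        using mult_right_mono[OF diff_le[of n k], of "r ^ k"] r by (simp add: abs_mult)
    qed
  qed auto
  hence \<delta>: "\<delta> \<longlonglongrightarrow> 0" unfolding \<delta>_def by simp
  have dist_le: "dist (conv_f \<alpha> n z) (f z) \<le> \<delta> n" if "z \<in> K" for n z
  proof -
    have z: "z \<in> ball 0 1" "norm z < 1" using that K by auto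
    have "(\<lambda>k. complex_of_real (limit_coeff \<alpha> k) * z ^ k) sums f z"
      unfolding f_def using z limit_coeff_nonneg limit_coeff_le_1
      by (intro summable_sums summable_bounded_coeffs) auto
    from sums_diff[OF conv_f_sums[OF z(1), of n] this]
    have sums: "(\<lambda>k. complex_of_real (conv_coeff \<alpha> n k - limit_coeff \<alpha> k) * z ^ k) sums (conv_f \<alpha> n z - f z)"
      by (simp add: algebra_simps)
    have "norm (\<Sum>k. complex_of_real (conv_coeff \<alpha> n k - limit_coeff \<alpha> k) * z ^ k) \<le> \<delta> n"
      unfolding \<delta>_def
    proof (rule norm_suminf_le)
      show "norm (complex_of_real (conv_coeff \<alpha> n k - limit_coeff \<alpha> k) * z ^ k)
          \<le> \<bar>conv_coeff \<alpha> n k - limit_coeff \<alpha> k\<bar> * r ^ k" for k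
        using r(3)[OF that] unfolding norm_mult norm_power norm_of_real
        by (intro mult_left_mono power_mono) auto
      show "summable (\<lambda>k. \<bar>conv_coeff \<alpha> n k - limit_coeff \<alpha> k\<bar> * r ^ k)"
        using diff_le r by (intro summable_bounded_coeffs) auto
    qed
    thus ?thesis unfolding sums_unique[OF sums, symmetric] by (simp add: dist_norm)
  qed
  show "uniform_limit K (conv_f \<alpha>) (\<lambda>z. \<Sum>k. complex_of_real (limit_coeff \<alpha> k) * z ^ k) sequentially"
    unfolding f_def[symmetric]
  proof (rule uniform_limitI)
    fix e :: real assume "0 < e"
    from order_tendstoD(2)[OF \<delta> this]
    show "\<forall>\<^sub>F n in sequentially. \<forall>x\<in>K. dist (conv_f \<alpha> n x) (f x) < e"
      by eventually_elim (use dist_le in \<open>auto intro: order.strict_trans1\<close>)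
  qed
qed

lemma loc_unif_limit_sums:
  assumes "loc_unif_limit_disk (conv_f \<alpha>) f" "z \<in> ball 0 1"
  shows "(\<lambda>k. complex_of_real (limit_coeff \<alpha> k) * z ^ k) sums f z"
proof -
  have lim: "(\<lambda>n. conv_f \<alpha> n z) \<longlonglongrightarrow> g z" if "loc_unif_limit_disk (conv_f \<alpha>) g" for g
    using that[unfolded loc_unif_limit_disk_def, rule_format, of "{z}"] assms(2) by simp
  have "f z = (\<Sum>k. complex_of_real (limit_coeff \<alpha> k) * z ^ k)"
    using LIMSEQ_unique[OF lim[OF assms(1)] lim[OF loc_unif_limit_exists]] .
  moreover have "summable (\<lambda>k. complex_of_real (limit_coeff \<alpha> k) * z ^ k)"
    using assms(2) limit_coeff_nonneg limit_coeff_le_1 by (intro summable_bounded_coeffs) auto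
  ultimately show ?thesis by (simp add: sums_iff)
qed

section \<open>Growth of the coefficients of the limit\<close>

lemma conv_coeff_le_powr:
  assumes "0 < k" "s = (\<Sum>i\<le>n. 1 - \<alpha> i)"
  shows "conv_coeff \<alpha> n k \<le> 2 powr s * real k powr (-s)"
proof -
  have "conv_coeff \<alpha> n k \<le> (\<Prod>i\<le>n. 2 powr (1 - \<alpha> i) * real k powr (- (1 - \<alpha> i)))"
    unfolding conv_coeff_def
  proof (intro prod_mono conjI)
    fix i
    show "0 \<le> coeff_f (\<alpha> i) k" using alpha[of i] by (intro coeff_f_nonneg) auto
    show "coeff_f (\<alpha> i) k \<le> 2 powr (1 - \<alpha> i) * real k powr (- (1 - \<alpha> i))"
      using coeff_f_powr_bounds(2)[of "\<alpha> i" k] alpha[of i] assms(1)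
      unfolding powr_minus by (simp add: field_simps del: minus_diff_eq)
  qed
  also have "\<dots> = 2 powr s * real k powr (-s)"
    unfolding assms(2) sum_negf[symmetric] using assms(1)
    by (simp add: prod.distrib powr_sum del: minus_diff_eq)
  finally show ?thesis .
qed

text \<open>
  The coefficients of the limit are dominated by those of each partial convolution, hence they are summable as
  soon as one partial sum of the \<open>1 - \<alpha> i\<close> exceeds 1. The sum of the coefficients then bounds \<open>f\<close>.
\<close>
lemma bounded_limit:
  assumes f: "loc_unif_limit_disk (conv_f \<alpha>) f" and s: "1 < (\<Sum>i\<le>n. 1 - \<alpha> i)"
  shows "bounded (f ` ball 0 1)"
proof -
  define s where "s = (\<Sum>i\<le>n. 1 - \<alpha> i)"
  have summable: "summable (limit_coeff \<alpha>)"
  proof (rule summable_comparison_test')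
    show "summable (\<lambda>k. 2 powr s * real k powr (-s))"
      using assms(2) by (intro summable_mult) (simp add: summable_real_powr_iff s_def)
    show "norm (limit_coeff \<alpha> k) \<le> 2 powr s * real k powr (-s)" if "k \<ge> 1" for k
      using limit_coeff_le[of k n] conv_coeff_le_powr[of k s n] that limit_coeff_nonneg[of k]
      by (simp add: s_def)
  qed
  have "norm (f z) \<le> (\<Sum>k. limit_coeff \<alpha> k)" if "z \<in> ball 0 1" for z
  proof -
    have sums: "(\<lambda>k. complex_of_real (limit_coeff \<alpha> k) * z ^ k) sums f z"
      by (rule loc_unif_limit_sums[OF f that])
    have "norm (\<Sum>k. complex_of_real (limit_coeff \<alpha> k) * z ^ k) \<le> (\<Sum>k. limit_coeff \<alpha> k)"
    proof (rule norm_suminf_le[OF _ summable])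
      show "norm (complex_of_real (limit_coeff \<alpha> k) * z ^ k) \<le> limit_coeff \<alpha> k" for k
        using limit_coeff_nonneg[of k] that mult_left_mono[of "norm z ^ k" 1 "limit_coeff \<alpha> k"]
        by (simp add: norm_mult norm_power power_le_one)
    qed
    thus ?thesis unfolding sums_unique[OF sums, symmetric] .
  qed
  thus ?thesis unfolding bounded_iff by blast
qed

text \<open>
  The factors \<open>k powr (1 - \<alpha> i)\<close> distribute the weight \<open>k powr b\<close> over the product, after which every
  factor converges as \<open>k\<close> tends to infinity. The logarithm of the \<open>i\<close>-th factor lies between
  \<open>ln (\<alpha> i)\<close> and \<open>(1 - \<alpha> i) * ln 2\<close>, so its modulus is at most \<open>(1 - \<alpha> i) / \<alpha> i\<close>. This majorant is
  summable because \<open>\<alpha> i\<close> tends to 1, and Tannery's theorem exchanges the limit with the sum of the logarithms.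
\<close>
lemma limit_coeff_asymp:
  assumes b: "(\<lambda>i. 1 - \<alpha> i) sums b"
  shows "convergent_prod (\<lambda>n. 1 / Gamma (\<alpha> n + 1))"
    and "(\<lambda>k. limit_coeff \<alpha> k * real k powr b) \<longlonglongrightarrow> (\<Prod>n. 1 / Gamma (\<alpha> n + 1)) / 2 powr b"
proof -
  have Gamma_pos: "Gamma (\<alpha> i + 1) > 0" for i
    using alpha[of i] by (intro Gamma_real_pos) auto
  define h where "h i k = ln (coeff_f (\<alpha> i) k * real k powr (1 - \<alpha> i))" for i k
  define l where "l i = ln (2 powr (\<alpha> i - 1) / Gamma (\<alpha> i + 1))" for i
  define M where "M i = (1 - \<alpha> i) / \<alpha> i" for i
  have summable_M: "summable M"
  proof (rule summable_comparison_test_ev)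
    show "summable (\<lambda>i. 2 * (1 - \<alpha> i))"
      using b by (intro summable_mult) (simp add: sums_iff)
    have "(\<lambda>i. 1 - (1 - \<alpha> i)) \<longlonglongrightarrow> 1 - 0"
      using b by (intro tendsto_intros summable_LIMSEQ_zero) (simp add: sums_iff)
    hence "eventually (\<lambda>i. \<alpha> i > 1 / 2) sequentially"
      by (intro order_tendstoD(1)) auto
    thus "eventually (\<lambda>i. norm (M i) \<le> 2 * (1 - \<alpha> i)) sequentially"
    proof eventually_elim
      case (elim i)
      have "(1 - \<alpha> i) * 1 \<le> (1 - \<alpha> i) * (2 * \<alpha> i)"
        using elim alpha[of i] by (intro mult_left_mono) auto
      thus ?case using alpha[of i] by (simp add: M_def pos_divide_le_eq mult_ac)
    qed
  qed
  have h_pos: "coeff_f (\<alpha> i) k * real k powr (1 - \<alpha> i) > 0" if "0 < k" for i k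
    using coeff_f_powr_bounds(1)[of "\<alpha> i" k] alpha[of i] that by linarith
  have h_bound: "\<bar>h i k\<bar> \<le> M i" if "0 < k" for i k
  proof -
    note ai = conjunct1[OF alpha[of i]] conjunct2[OF alpha[of i]]
    note bounds = coeff_f_powr_bounds[OF less_imp_le[OF ai(1)] ai(2) that]
    have "h i k \<le> ln (2 powr (1 - \<alpha> i))"
      unfolding h_def using bounds(2) h_pos[OF that] by (subst ln_le_cancel_iff) auto
    also have "\<dots> = (1 - \<alpha> i) * ln 2" by (simp add: ln_powr)
    also have "\<dots> \<le> (1 - \<alpha> i) * 1"
      using ai ln_2_less_1 by (intro mult_left_mono) auto
    also have "\<dots> \<le> M i"
      using ai mult_left_mono[of "\<alpha> i" 1 "1 - \<alpha> i"] by (simp add: M_def field_simps)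
    finally have "h i k \<le> M i" .
    moreover have "- M i \<le> h i k"
    proof -
      have "ln (1 / \<alpha> i) \<le> 1 / \<alpha> i - 1"
        using ai by (intro ln_le_minus_one) auto
      hence "- M i \<le> ln (\<alpha> i)"
        using ai by (simp add: M_def ln_div diff_divide_distrib)
      also have "\<dots> \<le> h i k"
        unfolding h_def using bounds(1) ai h_pos[OF that] by (subst ln_le_cancel_iff) auto
      finally show ?thesis .
    qed
    ultimately show ?thesis by (simp add: abs_le_iff)
  qed
  have tannery: "summable (\<lambda>i. norm (l i)) \<and> (\<lambda>k. \<Sum>i. h i k) \<longlonglongrightarrow> suminf l"
  proof (rule tannerys_theorem[where F = sequentially and M = M and a = h, THEN conjunct2])
    show "(\<lambda>k. h i k) \<longlonglongrightarrow> l i" for i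
      unfolding h_def l_def using alpha[of i] Gamma_pos[of i]
      by (intro tendsto_ln coeff_f_asymp) (auto simp: less_imp_neq[symmetric])
    have "eventually (\<lambda>x::nat \<times> nat. 0 < snd x) (sequentially \<times>\<^sub>F sequentially)"
      using eventually_prod2[of sequentially "\<lambda>k::nat. 0 < k" sequentially]
      by (simp add: case_prod_unfold)
    thus "eventually (\<lambda>(i, k). norm (h i k) \<le> M i) (sequentially \<times>\<^sub>F sequentially)"
      by eventually_elim (use h_bound in auto)
  qed (use summable_M in auto)
  \<comment> \<open>The powers of 2 in the limits of the factors are split off; together they contribute \<open>2 powr (-b)\<close>.\<close>
  define l' where "l' i = l i + (1 - \<alpha> i) * ln 2" for i
  have exp_l': "exp (l' i) = 1 / Gamma (\<alpha> i + 1)" for i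
  proof -
    have "exp (l' i) = 2 powr (\<alpha> i - 1) * 2 powr (1 - \<alpha> i) / Gamma (\<alpha> i + 1)"
      unfolding l'_def l_def exp_add using Gamma_pos[of i] by (simp add: powr_def)
    thus ?thesis by (simp flip: powr_add)
  qed
  have l': "l' sums (suminf l + b * ln 2)"
    unfolding l'_def
    by (rule sums_add[OF summable_sums[OF summable_norm_cancel[OF conjunct1[OF tannery]]] sums_mult2[OF b]])
  show conv: "convergent_prod (\<lambda>n. 1 / Gamma (\<alpha> n + 1))"
    using convergent_prod_exp[OF sums_summable[OF l']] by (simp add: exp_l')
  have "exp (suminf l + b * ln 2) = (\<Prod>n. 1 / Gamma (\<alpha> n + 1))"
    using prodinf_exp[OF sums_summable[OF l']] sums_unique[OF l'] by (simp add: exp_l')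
  hence exp_l: "exp (suminf l) = (\<Prod>n. 1 / Gamma (\<alpha> n + 1)) / 2 powr b"
    by (simp add: exp_add powr_def field_simps)
  have "exp (\<Sum>i. h i k) = limit_coeff \<alpha> k * real k powr b" if k: "0 < k" for k
  proof (rule LIMSEQ_unique)
    have "summable (\<lambda>i. h i k)"
      by (rule summable_comparison_test'[OF summable_M, of 0]) (use h_bound[OF k] in auto)
    hence "(\<lambda>n. \<Sum>i\<le>n. h i k) \<longlonglongrightarrow> (\<Sum>i. h i k)"
      by (rule summable_LIMSEQ')
    thus "(\<lambda>n. exp (\<Sum>i\<le>n. h i k)) \<longlonglongrightarrow> exp (\<Sum>i. h i k)"
      by (rule tendsto_exp)
    have "(\<lambda>n. conv_coeff \<alpha> n k * real k powr (\<Sum>i\<le>n. 1 - \<alpha> i)) \<longlonglongrightarrow> limit_coeff \<alpha> k * real k powr b"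
      using b k unfolding sums_def_le by (intro tendsto_intros conv_coeff_tendsto) auto
    moreover have "exp (\<Sum>i\<le>n. h i k) = conv_coeff \<alpha> n k * real k powr (\<Sum>i\<le>n. 1 - \<alpha> i)" for n
    proof -
      have "exp (\<Sum>i\<le>n. h i k) = (\<Prod>i\<le>n. coeff_f (\<alpha> i) k * real k powr (1 - \<alpha> i))"
        unfolding exp_sum[OF finite_atMost] h_def using h_pos[OF k] by simp
      thus ?thesis
        using k by (simp add: conv_coeff_def prod.distrib powr_sum)
    qed
    ultimately show "(\<lambda>n. exp (\<Sum>i\<le>n. h i k)) \<longlonglongrightarrow> limit_coeff \<alpha> k * real k powr b"
      by simp
  qed
  hence "eventually (\<lambda>k. exp (\<Sum>i. h i k) = limit_coeff \<alpha> k * real k powr b) sequentially"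
    by (rule eventually_mono[OF eventually_gt_at_top[of 0]])
  with tendsto_exp[OF conjunct2[OF tannery]]
  show "(\<lambda>k. limit_coeff \<alpha> k * real k powr b) \<longlonglongrightarrow> (\<Prod>n. 1 / Gamma (\<alpha> n + 1)) / 2 powr b"
    unfolding exp_l by (rule Lim_transform_eventually)
qed

end

section \<open>Radial limits\<close>

lemma tendsto_radial_at_1:
  assumes "((\<lambda>r. g (complex_of_real r)) \<longlongrightarrow> L) (at_left 1)"
  shows "(g \<longlongrightarrow> L) radial_at_1"
proof -
  have ev: "eventually (\<lambda>z. z \<in> complex_of_real ` {0<..<1}) radial_at_1"
    unfolding radial_at_1_def by (simp add: eventually_at_filter)
  have "filterlim Re (at_left 1) radial_at_1"
    unfolding filterlim_at
  proof
    show "eventually (\<lambda>z. Re z \<in> {..<1} \<and> Re z \<noteq> 1) radial_at_1"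
      using ev by eventually_elim auto
    have "(Re \<longlongrightarrow> Re 1) radial_at_1"
      unfolding radial_at_1_def by (intro tendsto_intros)
    thus "(Re \<longlongrightarrow> 1) radial_at_1" by simp
  qed
  from filterlim_compose[OF assms this]
  have "((\<lambda>z. g (complex_of_real (Re z))) \<longlongrightarrow> L) radial_at_1" .
  moreover have "eventually (\<lambda>z. g (complex_of_real (Re z)) = g z) radial_at_1"
    using ev by eventually_elim auto
  ultimately show ?thesis by (rule Lim_transform_eventually)
qed

text \<open>
  Here \<open>c k / coeff_g a k\<close> tends to \<open>L * Gamma (1 + a)\<close>, and the factor \<open>1 / a\<close> in the comparison function
  turns \<open>Gamma (1 + a)\<close> into \<open>Gamma a\<close>.
\<close>
lemma power_series_at_left_1_powr:
  fixes c :: "nat \<Rightarrow> real"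
  assumes F: "\<And>r. 0 < r \<Longrightarrow> r < 1 \<Longrightarrow> (\<lambda>k. c k * r ^ k) sums F r"
    and a: "0 < a" and lim: "(\<lambda>k. c k * real k powr (1 - a)) \<longlonglongrightarrow> L"
  shows "((\<lambda>r. (1 - r) powr a * F r) \<longlongrightarrow> L * Gamma a) (at_left 1)"
proof -
  have Gamma_pos: "Gamma (1 + a) > 0" using a by (intro Gamma_real_pos) auto
  have "(\<lambda>k. c k * real k powr (1 - a) / (coeff_g a k * real k powr (1 - a))) \<longlonglongrightarrow> L / (1 / Gamma (1 + a))"
    using Gamma_pos by (intro tendsto_divide lim coeff_g_asymp a) auto
  moreover have "eventually (\<lambda>k. c k * real k powr (1 - a) / (coeff_g a k * real k powr (1 - a)) =
      c k / coeff_g a k) sequentially"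
    using eventually_gt_at_top[of 0] by eventually_elim auto
  ultimately have "(\<lambda>k. c k / coeff_g a k) \<longlonglongrightarrow> L / (1 / Gamma (1 + a))"
    by (rule Lim_transform_eventually)
  moreover have "L / (1 / Gamma (1 + a)) / a = L * Gamma a"
    using a by (subst add.commute, subst Gamma_plus1) auto
  ultimately show ?thesis
    using power_series_at_left_1_of_ratio[OF F a] by metis
qed

lemma power_series_at_left_1_ln:
  fixes c :: "nat \<Rightarrow> real"
  assumes F: "\<And>r. 0 < r \<Longrightarrow> r < 1 \<Longrightarrow> (\<lambda>k. c k * r ^ k) sums F r"
    and lim: "(\<lambda>k. c k * real k) \<longlonglongrightarrow> L"
  shows "((\<lambda>r. F r / (- ln (1 - r))) \<longlongrightarrow> L) (at_left 1)"
proof (rule power_series_ratio_at_left_1[where a = c and b = "\<lambda>k. 1 / real k", OF F])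
  show "(\<lambda>k. 1 / real k * r ^ k) sums (- ln (1 - r))" if "0 < r" "r < 1" for r
    using sums_minus[OF ln_series'[of "-r"]] that by simp
  show "eventually (\<lambda>k. 0 < 1 / real k) sequentially"
    using eventually_gt_at_top[of 0] by eventually_elim auto
  show "(\<lambda>k. c k / (1 / real k)) \<longlonglongrightarrow> L" using lim by simp
  show "filterlim (\<lambda>r. - ln (1 - r)) at_top (at_left (1::real))" by real_asymp
qed auto

theorem theorem2p7:
  fixes \<alpha> :: "nat \<Rightarrow> real" and B :: ennreal
  assumes alpha: "\<And>n. 0 < \<alpha> n \<and> \<alpha> n \<le> 1"
    and B_def: "B = (\<Sum>n. ennreal (1 - \<alpha> n))"
    and B_pos: "0 < B"
  shows "(\<exists>f. loc_unif_limit_disk (conv_f \<alpha>) f) \<and>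
    (\<forall>f. loc_unif_limit_disk (conv_f \<alpha>) f \<longrightarrow>
      (B > 1 \<longrightarrow> bounded (f ` ball 0 1)) \<and>
      (B = 1 \<longrightarrow>
         convergent_prod (\<lambda>n. 1 / Gamma (\<alpha> n + 1)) \<and>
         ((\<lambda>z. f z / complex_of_real (- ln (1 - norm z))) \<longlongrightarrow>
            complex_of_real (1 / 2 * (\<Prod>n. 1 / Gamma (\<alpha> n + 1)))) radial_at_1) \<and>
      (B < 1 \<longrightarrow>
         convergent_prod (\<lambda>n. 1 / Gamma (\<alpha> n + 1)) \<and>
         ((\<lambda>z. complex_of_real ((1 - norm z) powr (1 - enn2real B)) * f z) \<longlongrightarrow>
            complex_of_real (Gamma (1 - enn2real B) / 2 powr (enn2real B) *
              (\<Prod>n. 1 / Gamma (\<alpha> n + 1)))) radial_at_1))"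
proof (intro conjI allI impI)
  show "\<exists>f. loc_unif_limit_disk (conv_f \<alpha>) f"
    using loc_unif_limit_exists[where \<alpha> = \<alpha>, OF alpha] by blast
next
  fix f assume f: "loc_unif_limit_disk (conv_f \<alpha>) f"
  let ?P = "\<Prod>n. 1 / Gamma (\<alpha> n + 1)"
  define F where "F r = (\<Sum>k. limit_coeff \<alpha> k * r ^ k)" for r :: real
  have F_sums: "(\<lambda>k. limit_coeff \<alpha> k * r ^ k) sums F r" if "0 < r" "r < 1" for r
    unfolding F_def using that limit_coeff_nonneg[where \<alpha> = \<alpha>, OF alpha] limit_coeff_le_1[where \<alpha> = \<alpha>, OF alpha]
    by (intro summable_sums summable_bounded_coeffs) auto
  have f_F: "f (of_real r) = of_real (F r)" if "0 < r" "r < 1" for r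
  proof (rule sums_unique2)
    show "(\<lambda>k. complex_of_real (limit_coeff \<alpha> k) * of_real r ^ k) sums f (of_real r)"
      using that by (intro loc_unif_limit_sums[where \<alpha> = \<alpha>, OF alpha f]) auto
    show "(\<lambda>k. complex_of_real (limit_coeff \<alpha> k) * of_real r ^ k) sums of_real (F r)"
      using sums_of_real[OF F_sums[OF that], where 'a = complex] by simp
  qed
  have ev: "eventually (\<lambda>r::real. r \<in> {0<..<1}) (at_left 1)"
    by (rule eventually_at_leftI) auto
  have ennreal_sum: "(\<Sum>i<n. ennreal (1 - \<alpha> i)) = ennreal (\<Sum>i<n. 1 - \<alpha> i)" for n
    using alpha by (intro sum_ennreal) auto
  have sums_B: "(\<lambda>i. 1 - \<alpha> i) sums enn2real B" if "B \<le> 1"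
  proof -
    have fin: "B \<noteq> top" using that by (auto simp: top_unique)
    have "summable (\<lambda>i. 1 - \<alpha> i)"
      using fin alpha unfolding B_def by (intro summable_suminf_not_top) auto
    moreover from this have "B = ennreal (\<Sum>i. 1 - \<alpha> i)"
      unfolding B_def using alpha by (intro suminf_ennreal2) auto
    moreover from \<open>summable _\<close> have "0 \<le> (\<Sum>i. 1 - \<alpha> i)"
      using alpha by (intro suminf_nonneg) auto
    ultimately show ?thesis by (simp add: sums_iff)
  qed
  show "bounded (f ` ball 0 1)" if "B > 1"
  proof -
    have "\<exists>n. 1 < (\<Sum>i<n. 1 - \<alpha> i)"
    proof (rule ccontr)
      assume "\<not> ?thesis"
      hence "(\<Sum>i<n. ennreal (1 - \<alpha> i)) \<le> 1" for n
        unfolding ennreal_sum by (subst ennreal_le_1) (auto simp: not_less)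
      hence "B \<le> 1"
        unfolding B_def by (intro suminf_le_const) auto
      thus False using that by simp
    qed
    then obtain n where "1 < (\<Sum>i<n. 1 - \<alpha> i)" ..
    also have "\<dots> \<le> (\<Sum>i\<le>n. 1 - \<alpha> i)"
      using alpha by (intro sum_mono2) auto
    finally show ?thesis by (rule bounded_limit[where \<alpha> = \<alpha>, OF alpha f])
  qed
  show "convergent_prod (\<lambda>n. 1 / Gamma (\<alpha> n + 1))" if "B = 1"
    using limit_coeff_asymp(1)[where \<alpha> = \<alpha>, OF alpha sums_B] that by simp
  show "convergent_prod (\<lambda>n. 1 / Gamma (\<alpha> n + 1))" if "B < 1"
    using limit_coeff_asymp(1)[where \<alpha> = \<alpha>, OF alpha sums_B] that by simp
  show "((\<lambda>z. f z / complex_of_real (- ln (1 - norm z))) \<longlongrightarrow> complex_of_real (1 / 2 * ?P)) radial_at_1" if "B = 1"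
  proof (rule tendsto_radial_at_1)
    have "(\<lambda>i. 1 - \<alpha> i) sums 1" using sums_B that by simp
    from limit_coeff_asymp(2)[where \<alpha> = \<alpha>, OF alpha this]
    have "(\<lambda>k. limit_coeff \<alpha> k * real k) \<longlonglongrightarrow> 1 / 2 * ?P" by simp
    from tendsto_of_real[OF power_series_at_left_1_ln[OF F_sums this]]
    have "((\<lambda>r. complex_of_real (F r / (- ln (1 - r)))) \<longlongrightarrow> complex_of_real (1 / 2 * ?P)) (at_left 1)" .
    moreover have "eventually (\<lambda>r. complex_of_real (F r / (- ln (1 - r))) =
        f (of_real r) / complex_of_real (- ln (1 - norm (complex_of_real r)))) (at_left 1)"
      using ev by eventually_elim (simp add: f_F)
    ultimately show "((\<lambda>r. f (of_real r) / complex_of_real (- ln (1 - norm (complex_of_real r))))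
        \<longlongrightarrow> complex_of_real (1 / 2 * ?P)) (at_left 1)"
      by (rule Lim_transform_eventually)
  qed
  show "((\<lambda>z. complex_of_real ((1 - norm z) powr (1 - enn2real B)) * f z) \<longlongrightarrow>
      complex_of_real (Gamma (1 - enn2real B) / 2 powr (enn2real B) * ?P)) radial_at_1" if "B < 1"
  proof (rule tendsto_radial_at_1)
    define b where "b = enn2real B"
    have "B = ennreal b"
      using that unfolding b_def by (intro ennreal_enn2real[symmetric]) (auto elim: order.strict_trans)
    hence "b < 1"
      using that ennreal_less_iff[of b 1] by (simp add: b_def)
    have "(\<lambda>i. 1 - \<alpha> i) sums b" using sums_B that by (simp add: b_def)
    from limit_coeff_asymp(2)[where \<alpha> = \<alpha>, OF alpha this]
    have "(\<lambda>k. limit_coeff \<alpha> k * real k powr (1 - (1 - b))) \<longlonglongrightarrow> ?P / 2 powr b" by simp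
    from power_series_at_left_1_powr[OF F_sums _ this] \<open>b < 1\<close>
    have "((\<lambda>r. (1 - r) powr (1 - b) * F r) \<longlongrightarrow> Gamma (1 - b) / 2 powr b * ?P) (at_left 1)"
      by (simp add: mult_ac)
    hence "((\<lambda>r. complex_of_real ((1 - r) powr (1 - b) * F r)) \<longlongrightarrow> complex_of_real (Gamma (1 - b) / 2 powr b * ?P)) (at_left 1)"
      by (rule tendsto_of_real)
    moreover have "eventually (\<lambda>r. complex_of_real ((1 - r) powr (1 - b) * F r) =
        complex_of_real ((1 - norm (complex_of_real r)) powr (1 - b)) * f (of_real r)) (at_left 1)"
      using ev by eventually_elim (simp add: f_F)
    ultimately show "((\<lambda>r. complex_of_real ((1 - norm (complex_of_real r)) powr (1 - enn2real B)) * f (of_real r)) \<longlongrightarrow>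
      complex_of_real (Gamma (1 - enn2real B) / 2 powr (enn2real B) * ?P)) (at_left 1)"
      unfolding b_def by (rule Lim_transform_eventually)
  qed
qed

end
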